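(* Let $T$ be a tree of order $n$ with $\operatorname{diam}(T)\geq 3$. Then $$n-\beta(T)\;\leq\;\gamma_{t,coi}(T)\;\leq\; n-|L(T)|.$$
   Context: All graphs are finite, simple and undirected. For a graph $G$, a set $D\subseteq V(G)$ is a total dominating set if every vertex of $G$ (including those in $D$) has at least one neighbor in $D$. A total dominating set $D$ is a total co-independent dominating set if $V(G)\setminus D$ is nonempty and independent (no two of its vertices are adjacent). $\gamma_{t,coi}(G)$ denotes the minimum cardinality of a total co-independent dominating set of $G$. $\beta(G)$ is the independence number (maximum size of an independent set). For a tree $T$, a leaf is a vertex of degree one and $L(T)$ is the set of leaves of $T$. *)

theory Defs
  imports "Graph_Theory.Graph_Theory"
begin

text \<open>Finite simple undirected graphs are the symmetric digraphs of the locale \<^locale>\<open>graph\<close>;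
  adjacency is \<open>u \<rightarrow>\<^bsub>G\<^esub> v\<close>.\<close>

text \<open>In a symmetric digraph every edge \<open>uv\<close> yields the directed cycle \<open>u, v, u\<close>, so
  \<^const>\<open>forest\<close> and \<^const>\<open>tree\<close> do not describe undirected forests and trees.
  The cycles of the underlying undirected graph are exactly the directed cycles of length at least 3.\<close>

definition undirected_tree :: "('a, 'b) pre_digraph \<Rightarrow> bool" where
  "undirected_tree G \<longleftrightarrow>
     graph G \<and> Digraph_Component.connected G \<and>
     \<not> (\<exists>p. pre_digraph.cycle G p \<and> length p \<ge> 3)"

definition diameter :: "('a, 'b) pre_digraph \<Rightarrow> ereal" where
  "diameter G = (SUP u\<in>verts G. SUP v\<in>verts G. wf_digraph.\<mu> G (\<lambda>_. 1) u v)"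

text \<open>Each undirected edge at \<open>v\<close> contributes exactly one outgoing arc, so the degree is the
  out-degree.\<close>

definition leaves :: "('a, 'b) pre_digraph \<Rightarrow> 'a set" where
  "leaves G = {v \<in> verts G. out_degree G v = 1}"

definition independent_set :: "('a, 'b) pre_digraph \<Rightarrow> 'a set \<Rightarrow> bool" where
  "independent_set G S \<longleftrightarrow> S \<subseteq> verts G \<and> (\<forall>u\<in>S. \<forall>v\<in>S. \<not> u \<rightarrow>\<^bsub>G\<^esub> v)"

definition independence_number :: "('a, 'b) pre_digraph \<Rightarrow> nat" where
  "independence_number G = Max (card ` {S. independent_set G S})"

definition total_dominating_set :: "('a, 'b) pre_digraph \<Rightarrow> 'a set \<Rightarrow> bool" where
  "total_dominating_set G D \<longleftrightarrow> D \<subseteq> verts G \<and> (\<forall>v\<in>verts G. \<exists>u\<in>D. v \<rightarrow>\<^bsub>G\<^esub> u)"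

definition total_coindependent_dominating_set :: "('a, 'b) pre_digraph \<Rightarrow> 'a set \<Rightarrow> bool" where
  "total_coindependent_dominating_set G D \<longleftrightarrow>
     total_dominating_set G D \<and> verts G - D \<noteq> {} \<and> independent_set G (verts G - D)"

definition total_coindependent_domination_number :: "('a, 'b) pre_digraph \<Rightarrow> nat" where
  "total_coindependent_domination_number G =
     Min (card ` {D. total_coindependent_dominating_set G D})"

end

theory Submission
  imports Defs
begin

text \<open>The upper bound is witnessed by the set of non-leaves. If all neighbours of some vertex
  \<open>v\<close> were leaves, then \<open>v\<close> and its neighbours would form a connected component, so the tree would
  be a star and have diameter at most 2. Hence every vertex has a non-leaf neighbour, which says
  that the non-leaves are totally dominating and, applied to a leaf, that the leaves are
  independent. A leaf exists at the start of any longest path, since a second neighbour of its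
  first vertex would extend the path or close a cycle. For the lower bound, the complement of a
  total co-independent dominating set is independent.\<close>

lemma (in wf_digraph) strongly_connected_closed_eq_verts:
  assumes "strongly_connected G" "S \<subseteq> verts G" "S \<noteq> {}" and closed: "arcs_ends G `` S \<subseteq> S"
  shows "S = verts G"
proof
  obtain u where "u \<in> S"
    using \<open>S \<noteq> {}\<close> by blast
  show "verts G \<subseteq> S"
  proof
    fix v assume "v \<in> verts G"
    with assms(1,2) \<open>u \<in> S\<close> have "u \<rightarrow>\<^sup>* v"
      by (auto simp: strongly_connected_def)
    with \<open>u \<in> S\<close> have "v \<in> (arcs_ends G)\<^sup>* `` S"
      by (blast dest: reachable_rtranclI)
    with closed show "v \<in> S"
      by (simp add: Image_closed_trancl)
  qed
qed fact

lemma (in wf_digraph) \<mu>_triangle: "\<mu> c u w \<le> \<mu> c u v + \<mu> c v w"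
proof -
  have walk: "\<mu> c u w \<le> ereal (awalk_cost c p) + ereal (awalk_cost c q)"
    if "awalk u p v" "awalk v q w" for p q
    using min_cost_le_walk_cost[of u "p @ q" w c] that by auto
  have walk_\<mu>: "\<mu> c u w \<le> ereal (awalk_cost c p) + \<mu> c v w" if "awalk u p v" for p
  proof -
    have "\<mu> c u w - ereal (awalk_cost c p) \<le> \<mu> c v w"
      unfolding \<mu>_def[of c v w] using walk[OF that]
      by (intro INF_greatest) (simp add: ereal_minus_le add.commute)
    then show ?thesis
      by (simp add: ereal_minus_le add.commute)
  qed
  show ?thesis
  proof (cases "\<mu> c v w")
    case (real r)
    have "\<mu> c u w - ereal r \<le> \<mu> c u v"
      unfolding \<mu>_def[of c u v] using walk_\<mu> real
      by (intro INF_greatest) (simp add: ereal_minus_le)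
    with real show ?thesis
      by (simp add: ereal_minus_le)
  next
    case PInf
    then show ?thesis
      by simp
  next
    case MInf
    show ?thesis
    proof (cases "u \<rightarrow>\<^sup>* v")
      case True
      with walk_\<mu> MInf show ?thesis
        by (auto simp: reachable_awalk)
    next
      case False
      then show ?thesis
        by (simp add: shortest_path_inf)
    qed
  qed
qed

lemma (in wf_digraph) \<mu>_self_le_0:
  assumes "v \<in> verts G"
  shows "\<mu> c v v \<le> 0"
  using min_cost_le_walk_cost[of v "[]" v c] assms by (simp add: awalk_Nil_iff zero_ereal_def)

lemma (in wf_digraph) \<mu>_le_arc_cost:
  assumes "e \<in> arcs G"
  shows "\<mu> c (tail G e) (head G e) \<le> c e"
  using min_cost_le_walk_cost[OF arc_implies_awalk[OF assms], of c] by simp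

lemma (in sym_digraph) diameter_le_2_if_universal_vertex:
  assumes "v \<in> verts G" and universal: "\<And>u. u \<in> verts G \<Longrightarrow> u \<noteq> v \<Longrightarrow> v \<rightarrow>\<^bsub>G\<^esub> u"
  shows "diameter G \<le> 2"
proof -
  have adjacent: "\<mu> (\<lambda>_. 1) x y \<le> 1" if "x \<rightarrow>\<^bsub>G\<^esub> y" for x y
    using that \<mu>_le_arc_cost[of _ "\<lambda>_. 1"] by (auto simp: one_ereal_def)
  have near: "\<mu> (\<lambda>_. 1) v u \<le> 1 \<and> \<mu> (\<lambda>_. 1) u v \<le> 1" if "u \<in> verts G" for u
  proof (cases "u = v")
    case True
    with \<mu>_self_le_0[OF \<open>v \<in> verts G\<close>, of "\<lambda>_. 1"] show ?thesis
      by (auto intro: order_trans)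
  next
    case False
    with that show ?thesis
      by (simp add: adjacent graph_symmetric universal)
  qed
  have "\<mu> (\<lambda>_. 1) x y \<le> 2" if "x \<in> verts G" "y \<in> verts G" for x y
  proof -
    have "\<mu> (\<lambda>_. 1) x y \<le> \<mu> (\<lambda>_. 1) x v + \<mu> (\<lambda>_. 1) v y"
      by (rule \<mu>_triangle)
    also have "\<dots> \<le> 1 + 1"
      using near that by (intro add_mono) auto
    finally show ?thesis
      by simp
  qed
  then show ?thesis
    unfolding diameter_def by (intro SUP_least)
qed

lemma (in nomulti_digraph) out_degree_eq_card_dominated: "out_degree G u = card {v. u \<rightarrow>\<^bsub>G\<^esub> v}"
proof -
  have "inj_on (head G) (out_arcs G u)"
    by (auto intro!: inj_onI no_multi_arcs simp: arc_to_ends_def)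
  moreover have "head G ` out_arcs G u = {v. u \<rightarrow>\<^bsub>G\<^esub> v}"
    by (auto simp: arcs_ends_conv)
  ultimately show ?thesis
    unfolding out_degree_def by (metis card_image)
qed

lemma (in nomulti_digraph) leaves_iff_ex1_dominated: "u \<in> leaves G \<longleftrightarrow> (\<exists>!v. u \<rightarrow>\<^bsub>G\<^esub> v)"
proof -
  have "out_degree G u = 1 \<longleftrightarrow> (\<exists>!v. u \<rightarrow>\<^bsub>G\<^esub> v)"
    using is_singleton_altdef[of "{v. u \<rightarrow>\<^bsub>G\<^esub> v}"]
    by (simp add: out_degree_eq_card_dominated is_singleton_iff_ex1)
  then show ?thesis
    using adj_in_verts(1) by (auto simp: leaves_def)
qed

lemma (in wf_digraph) cycle_Cons_if_apath:
  assumes "apath u p v" "e \<in> arcs G" "tail G e = v" "head G e = u"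
  shows "cycle (e # p)"
  using assms unfolding cycle_def apath_def by (auto simp: awalk_Cons_iff)

definition (in pre_digraph) longest_apath :: "'a \<Rightarrow> 'b awalk \<Rightarrow> 'a \<Rightarrow> bool" where
  "longest_apath u p v \<longleftrightarrow> apath u p v \<and> (\<forall>x q y. apath x q y \<longrightarrow> length q \<le> length p)"

lemma (in fin_digraph) exists_longest_apath:
  assumes "verts G \<noteq> {}"
  obtains u p v where "longest_apath u p v"
proof -
  let ?is_length = "\<lambda>n. \<exists>u p v. apath u p v \<and> length p = n"
  have "?is_length 0"
    using assms by (auto simp: apath_Nil_iff)
  have bound: "n \<le> card (verts G)" if "?is_length n" for n
    using that length_apath by blast
  obtain u p v where "apath u p v" "length p = Greatest ?is_length"
    using GreatestI_nat[of ?is_length, OF \<open>?is_length 0\<close> bound] by blast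
  moreover have "length q \<le> Greatest ?is_length" if "apath x q y" for x q y
    using that by (intro Greatest_le_nat[of ?is_length, OF _ bound]) blast+
  ultimately have "longest_apath u p v"
    unfolding longest_apath_def by simp
  then show ?thesis
    by (rule that)
qed

lemma (in wf_digraph) dominating_start_in_longest_apath:
  assumes "longest_apath u p v" "w \<rightarrow>\<^bsub>G\<^esub> u"
  shows "w \<in> set (awalk_verts u p)"
proof (rule ccontr)
  assume "w \<notin> set (awalk_verts u p)"
  moreover obtain e where "e \<in> arcs G" "tail G e = w" "head G e = u"
    using \<open>w \<rightarrow>\<^bsub>G\<^esub> u\<close> by blast
  ultimately have "apath w (e # p) v"
    using assms(1) by (simp add: longest_apath_def apath_Cons_iff)
  with assms(1) have "length (e # p) \<le> length p"
    unfolding longest_apath_def by blast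
  then show False
    by simp
qed

context graph
begin

lemma neighbour_of_longest_apath_start:
  assumes acyclic: "\<And>p. cycle p \<Longrightarrow> length p < 3"
    and longest: "longest_apath u p v" and "u \<rightarrow>\<^bsub>G\<^esub> w"
  shows "w = head G (hd p)"
proof -
  have "w \<rightarrow>\<^bsub>G\<^esub> u"
    using \<open>u \<rightarrow>\<^bsub>G\<^esub> w\<close> by (rule graph_symmetric)
  with longest have "w \<in> set (awalk_verts u p)"
    by (rule dominating_start_in_longest_apath)
  moreover have "apath u p v"
    using longest by (simp add: longest_apath_def)
  ultimately obtain q r where "p = q @ r" "apath u q w"
    using awalk_decomp[of u p v w] by (metis apath_append_iff apath_def awalk_ends_eqD)
  moreover obtain e where "e \<in> arcs G" "tail G e = w" "head G e = u"
    using \<open>w \<rightarrow>\<^bsub>G\<^esub> u\<close> by blast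
  ultimately have "length (e # q) < 3"
    by (intro acyclic cycle_Cons_if_apath)
  moreover have "q \<noteq> []"
    using \<open>apath u q w\<close> \<open>u \<rightarrow>\<^bsub>G\<^esub> w\<close> adj_not_same by (auto simp: apath_Nil_iff)
  ultimately obtain a where "q = [a]"
    by (cases q) auto
  with \<open>apath u q w\<close> \<open>p = q @ r\<close> show ?thesis
    by (simp add: apath_simps)
qed

lemma leaves_nonempty:
  assumes acyclic: "\<And>p. cycle p \<Longrightarrow> length p < 3" and "arcs G \<noteq> {}"
  shows "leaves G \<noteq> {}"
proof -
  obtain a where "a \<in> arcs G"
    using \<open>arcs G \<noteq> {}\<close> by blast
  then obtain u p v where longest: "longest_apath u p v"
    using exists_longest_apath tail_in_verts by blast
  have "apath (tail G a) [a] (head G a)"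
    using \<open>a \<in> arcs G\<close> no_loops by (auto simp: apath_simps)
  with longest have "length [a] \<le> length p"
    unfolding longest_apath_def by blast
  then obtain e q where "p = e # q"
    by (cases p) auto
  with longest have "u \<rightarrow>\<^bsub>G\<^esub> head G e"
    by (auto simp: longest_apath_def apath_Cons_iff dest: in_arcs_imp_in_arcs_ends)
  then have "u \<in> leaves G"
    using neighbour_of_longest_apath_start[OF acyclic longest] \<open>p = e # q\<close>
    unfolding leaves_iff_ex1_dominated by auto
  then show ?thesis
    by blast
qed

lemma universal_vertex_if_neighbours_leaves:
  assumes "Digraph_Component.connected G" "v \<in> verts G" and "\<And>u. v \<rightarrow>\<^bsub>G\<^esub> u \<Longrightarrow> u \<in> leaves G"
    and "u \<in> verts G" "u \<noteq> v"
  shows "v \<rightarrow>\<^bsub>G\<^esub> u"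
proof -
  have "insert v {u. v \<rightarrow>\<^bsub>G\<^esub> u} = verts G"
  proof (rule strongly_connected_closed_eq_verts)
    show "strongly_connected G"
      using sym_arcs assms(1) by (rule symmetric_connected_imp_strongly_connected)
    show "arcs_ends G `` insert v {u. v \<rightarrow>\<^bsub>G\<^esub> u} \<subseteq> insert v {u. v \<rightarrow>\<^bsub>G\<^esub> u}"
      using assms(3) graph_symmetric leaves_iff_ex1_dominated by blast
  qed (use \<open>v \<in> verts G\<close> adj_in_verts in auto)
  with \<open>u \<in> verts G\<close> \<open>u \<noteq> v\<close> show ?thesis
    by blast
qed

lemma exists_nonleaf_neighbour:
  assumes "Digraph_Component.connected G" "diameter G \<ge> 3" "v \<in> verts G"
  obtains u where "u \<in> verts G - leaves G" "v \<rightarrow>\<^bsub>G\<^esub> u"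
proof (rule ccontr)
  assume "\<not> thesis"
  with that have "u \<in> leaves G" if "v \<rightarrow>\<^bsub>G\<^esub> u" for u
    using that adj_in_verts by blast
  with assms(1,3) have "v \<rightarrow>\<^bsub>G\<^esub> u" if "u \<in> verts G" "u \<noteq> v" for u
    using that by (intro universal_vertex_if_neighbours_leaves)
  with \<open>v \<in> verts G\<close> have "diameter G \<le> 2"
    by (rule diameter_le_2_if_universal_vertex)
  with \<open>diameter G \<ge> 3\<close> have "(3 :: ereal) \<le> 2"
    by (rule order_trans)
  then show False
    by simp
qed

lemma nonleaves_total_dominating_set:
  assumes "Digraph_Component.connected G" "diameter G \<ge> 3"
  shows "total_dominating_set G (verts G - leaves G)"
  using exists_nonleaf_neighbour[OF assms] unfolding total_dominating_set_def by blast

lemma leaves_independent_set: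
  assumes "total_dominating_set G (verts G - leaves G)"
  shows "independent_set G (leaves G)"
  unfolding independent_set_def
proof (intro conjI ballI notI)
  show "leaves G \<subseteq> verts G"
    by (auto simp: leaves_def)
  fix u v assume "u \<in> leaves G" "v \<in> leaves G" "u \<rightarrow>\<^bsub>G\<^esub> v"
  moreover obtain w where "w \<notin> leaves G" "u \<rightarrow>\<^bsub>G\<^esub> w"
    using assms \<open>u \<rightarrow>\<^bsub>G\<^esub> v\<close> adj_in_verts(1) unfolding total_dominating_set_def by blast
  ultimately show False
    using leaves_iff_ex1_dominated by blast
qed

lemma nonleaves_total_coindependent_dominating_set:
  assumes "undirected_tree G" "diameter G \<ge> 3"
  shows "total_coindependent_dominating_set G (verts G - leaves G)"
proof -
  have "Digraph_Component.connected G" and acyclic: "\<And>p. cycle p \<Longrightarrow> length p < 3"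
    using assms(1) by (auto simp: undirected_tree_def not_le)
  then have dominating: "total_dominating_set G (verts G - leaves G)"
    using assms(2) by (intro nonleaves_total_dominating_set)
  then have independent: "independent_set G (leaves G)"
    by (rule leaves_independent_set)
  have "verts G \<noteq> {}"
    using \<open>Digraph_Component.connected G\<close>
    by (auto simp: Digraph_Component.connected_def strongly_connected_def)
  then have "arcs G \<noteq> {}"
    using dominating by (auto simp: total_dominating_set_def arcs_ends_conv)
  with acyclic have "leaves G \<noteq> {}"
    by (rule leaves_nonempty)
  moreover have "verts G - (verts G - leaves G) = leaves G"
    using independent by (auto simp: independent_set_def)
  ultimately show ?thesis
    using dominating independent by (simp add: total_coindependent_dominating_set_def)
qed

end

context fin_digraph
begin

lemma finite_total_coindependent_dominating_sets:
  "finite {D. total_coindependent_dominating_set G D}"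
  by (rule finite_subset[of _ "Pow (verts G)"])
    (auto simp: total_coindependent_dominating_set_def total_dominating_set_def)

lemma total_coindependent_domination_number_le:
  assumes "total_coindependent_dominating_set G D"
  shows "total_coindependent_domination_number G \<le> card D"
  unfolding total_coindependent_domination_number_def
  using assms finite_total_coindependent_dominating_sets by (intro Min_le) auto

lemma total_coindependent_domination_number_attained:
  assumes "total_coindependent_dominating_set G D\<^sub>0"
  obtains D where "total_coindependent_dominating_set G D"
    "card D = total_coindependent_domination_number G"
proof -
  have "total_coindependent_domination_number G
      \<in> card ` {D. total_coindependent_dominating_set G D}"
    unfolding total_coindependent_domination_number_def
    using assms finite_total_coindependent_dominating_sets by (intro Min_in) auto
  with that show ?thesis
    by auto
qed

lemma card_le_independence_number:
  assumes "independent_set G S"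
  shows "card S \<le> independence_number G"
proof -
  have "finite {S. independent_set G S}"
    by (rule finite_subset[of _ "Pow (verts G)"]) (auto simp: independent_set_def)
  then show ?thesis
    unfolding independence_number_def using assms by (intro Max_ge) auto
qed

lemma card_verts_le_card_plus_independence_number:
  assumes "D \<subseteq> verts G" "independent_set G (verts G - D)"
  shows "card (verts G) \<le> card D + independence_number G"
proof -
  have "card (verts G) = card D + card (verts G - D)"
    using assms(1) by (metis card_Int_Diff finite_verts inf.absorb2)
  also have "\<dots> \<le> card D + independence_number G"
    using assms(2) by (simp add: card_le_independence_number)
  finally show ?thesis .
qed

end

theorem theorem1:
  fixes T :: "('a, 'b) pre_digraph" and n :: nat
  assumes "undirected_tree T"
    and "card (verts T) = n"
    and "diameter T \<ge> 3"
  shows "int n - int (independence_number T) \<le> int (total_coindependent_domination_number T)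
       \<and> int (total_coindependent_domination_number T) \<le> int n - int (card (leaves T))"
proof -
  interpret graph T
    using assms(1) by (simp add: undirected_tree_def)
  note nonleaves = nonleaves_total_coindependent_dominating_set[OF assms(1,3)]
  obtain D where "total_coindependent_dominating_set T D"
    and "card D = total_coindependent_domination_number T"
    using total_coindependent_domination_number_attained[OF nonleaves] .
  then have lower: "n \<le> total_coindependent_domination_number T + independence_number T"
    using card_verts_le_card_plus_independence_number[of D] assms(2)
    by (simp add: total_coindependent_dominating_set_def total_dominating_set_def)
  have "leaves T \<subseteq> verts T"
    by (auto simp: leaves_def)
  then have "card (verts T - leaves T) = n - card (leaves T)" "card (leaves T) \<le> n"
    using assms(2) by (auto simp: card_Diff_subset finite_subset card_mono)
  with total_coindependent_domination_number_le[OF nonleaves] lower show ?thesis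
    by linarith
qed

end
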